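(* Let $X$ be a topological space and let $\lambda$ and $\mu$ be infinite cardinals. The following are equivalent. (1) $X$ is $\mathcal O$-$[\mu,\lambda]$-compact. (2) For every sequence $(P_\alpha)_{\alpha\in\lambda}$ of subsets of $X$, if for every $Z\subseteq\lambda$ with $|Z|<\mu$ there exists a nonempty open set $O_Z$ of $X$ such that $\bigcap_{\alpha\in Z}P_\alpha\supseteq O_Z$, then $\bigcap_{\alpha\in\lambda}\overline{P_\alpha}\neq\emptyset$. (3) For every sequence $(Q_\alpha)_{\alpha\in\lambda}$ of open sets of $X$, if for every $Z\subseteq\lambda$ with $|Z|<\mu$ there exists a nonempty open set $O_Z$ of $X$ such that $\bigcap_{\alpha\in Z}Q_\alpha\supseteq O_Z$, then $\bigcap_{\alpha\in\lambda}\overline{Q_\alpha}\neq\emptyset$. (4) For every sequence $\{O_Z\mid Z\in S_\mu(\lambda)\}$ of nonempty open sets of $X$, we have $\bigcap_{\alpha\in\lambda}\overline{\bigcup\{O_Z\mid Z\in S_\mu(\lambda),\ \alpha\in Z\}}\neq\emptyset$. (5) For every sequence $\{O_Z\mid Z\in S_\mu(\lambda)\}$ of nonempty open sets of $X$, the following holds: if for every finite subset $W$ of $\lambda$ we put $Q_W=\bigcup\{O_Z\mid Z\in S_\mu(\lambda)\text{ and }Z\supseteq W\}$, then $\bigcap\{\overline{Q_W}\mid W\text{ is a finite subset of }\lambda\}\neq\emptyset$. (6) For every sequence $\{C_Z\mid Z\in S_\mu(\lambda)\}$ of closed sets of $X$ such that each $C_Z$ is properly contained in $X$, if for $\alpha\in\lambda$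 we let $P_\alpha$ be the interior of $\bigcap\{C_Z\mid Z\in S_\mu(\lambda),\ \alpha\in Z\}$, then $(P_\alpha)_{\alpha\in\lambda}$ is not a cover of $X$.
   Context: No separation axiom is assumed. $S_\mu(\lambda)$ denotes the set of all subsets of $\lambda$ of cardinality $<\mu$. "Sequence" means an indexed family (repetitions allowed). Intersections over an empty index set of subsets of $X$ equal $X$. A topological space $X$ is $\mathcal O$-$[\mu,\lambda]$-compact if for every sequence $(C_\alpha)_{\alpha\in\lambda}$ of closed sets of $X$ the following holds: if for every $Z\subseteq\lambda$ with $|Z|<\mu$ there exists a nonempty open set $O_Z$ of $X$ such that $\bigcap_{\alpha\in Z}C_\alpha\supseteq O_Z$, then $\bigcap_{\alpha\in\lambda}C_\alpha\neq\emptyset$. *)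

theory Defs
  imports "HOL-Analysis.Abstract_Topology"
begin

unbundle cardinal_syntax

text \<open>
  A cardinal is represented by a relation satisfying \<^const>\<open>Card_order\<close>, on any type;
  its underlying set is the \<^const>\<open>Field\<close> of the relation. A sequence indexed by a cardinal
  \<open>\<Lambda>\<close> is a total function of which only the values on \<open>Field \<Lambda>\<close> matter.
\<close>

definition small_subsets :: "'c rel \<Rightarrow> 'i rel \<Rightarrow> 'i set set" where
  "small_subsets \<mu> \<Lambda> = {Z. Z \<subseteq> Field \<Lambda> \<and> |Z| <o \<mu>}"

text \<open>
  Intersection of subsets of the space \<open>X\<close>. The factor \<open>topspace X\<close> makes the intersection
  over the empty index set equal to the whole space.
\<close>

definition Inter_in :: "'a topology \<Rightarrow> 'i set \<Rightarrow> ('i \<Rightarrow> 'a set) \<Rightarrow> 'a set" where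
  "Inter_in X I A = topspace X \<inter> (\<Inter>i\<in>I. A i)"

definition O_compact :: "'c rel \<Rightarrow> 'i rel \<Rightarrow> 'a topology \<Rightarrow> bool" where
  "O_compact \<mu> \<Lambda> X \<longleftrightarrow>
    (\<forall>C :: 'i \<Rightarrow> 'a set.
      (\<forall>\<alpha>\<in>Field \<Lambda>. closedin X (C \<alpha>)) \<longrightarrow>
      (\<forall>Z\<in>small_subsets \<mu> \<Lambda>. \<exists>U. openin X U \<and> U \<noteq> {} \<and> U \<subseteq> Inter_in X Z C) \<longrightarrow>
      Inter_in X (Field \<Lambda>) C \<noteq> {})"

end

theory Submission
  imports Defs
begin

text \<open>
  The whole proposition turns on one choice and one reindexing.

  Choosing, for every small \<open>Z\<close>, a witness \<open>U Z\<close> of the hypothesis on \<open>C\<close> turns a sequence of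
  sets into a sequence of nonempty open sets indexed by the small \<open>Z\<close>, and the inclusion
  \<open>U Z \<subseteq> C \<alpha>\<close> for all \<open>\<alpha> \<in> Z\<close> says exactly that \<open>C \<alpha>\<close> contains
  \<open>V \<alpha> = \<Union>{U Z | \<alpha> \<in> Z}\<close>. Conversely, any such family \<open>U\<close> makes the sequence \<open>V\<close> of open sets
  satisfy that hypothesis, with \<open>U Z\<close> itself as a witness. So \<open>V\<close> is the
  smallest sequence with the witnesses \<open>U\<close>, and it consists of open sets. Hence the equivalences
  follow in a cycle: closed sets, arbitrary sets (through their closures), open sets, families
  \<open>U\<close>, and back to closed sets, because a closed \<open>C \<alpha>\<close> contains the closure of \<open>V \<alpha>\<close>.
  Taking complements turns the condition on families \<open>U\<close> into the one on covers by interiors.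

  The condition with finite sets \<open>W\<close> seems stronger, since it asks for a point in more
  closures. But an infinite cardinal \<open>\<Lambda>\<close> has only \<open>\<Lambda>\<close> finite subsets, so
  these can be enumerated by \<open>\<Lambda>\<close>, say as \<open>e \<alpha>\<close>, and the condition with single indices can be
  applied to the family \<open>Z \<mapsto> U (\<Union>\<alpha>\<in>Z. e \<alpha>)\<close>. This is a family over small sets because a union of
  fewer than \<open>\<mu>\<close> finite sets has again fewer than \<open>\<mu>\<close> elements: it is finite, or no larger
  than its index set.
\<close>

section \<open>Finite subsets of an infinite set\<close>

lemma card_of_finite_ordLess_infinite:
  assumes "finite A" "infinite B"
  shows "|A| <o |B|"
  using assms by (meson card_of_Well_order card_of_ordLeq_finite not_ordLeq_iff_ordLess)

fun subsets_by_insertions :: "'i set \<Rightarrow> nat \<Rightarrow> 'i set set" where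
  "subsets_by_insertions A 0 = {{}}"
| "subsets_by_insertions A (Suc n) = (\<lambda>(a, W). insert a W) ` (A \<times> subsets_by_insertions A n)"

lemma card_of_subsets_by_insertions:
  assumes "infinite A"
  shows "|subsets_by_insertions A n| \<le>o |A|"
proof (induction n)
  case 0
  show ?case
    using assms by (simp add: ordLess_imp_ordLeq card_of_finite_ordLess_infinite)
next
  case (Suc n)
  have "|subsets_by_insertions A (Suc n)| \<le>o |A \<times> subsets_by_insertions A n|"
    by (simp add: card_of_image)
  also have "|A \<times> subsets_by_insertions A n| \<le>o |A|"
    using assms Suc card_of_refl[THEN ordIso_imp_ordLeq]
    by (intro card_of_Times_ordLeq_infinite_Field) (simp_all add: card_of_card_order_on Field_card_of)
  finally show ?case .
qed

text \<open>
  A finite set arises by as many insertions as it has elements, so the finite subsets of \<open>A\<close>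
  form a union of countably many sets, none larger than \<open>A\<close>.
\<close>

lemma card_of_finite_subsets:
  assumes "infinite A"
  shows "|{W. W \<subseteq> A \<and> finite W}| \<le>o |A|"
proof -
  have "\<exists>n. W \<in> subsets_by_insertions A n" if "finite W" "W \<subseteq> A" for W
    using that
  proof (induction W)
    case empty
    show ?case by (rule exI[of _ 0]) simp
  next
    case (insert a W)
    then obtain n where "W \<in> subsets_by_insertions A n" by auto
    then show ?case using insert.prems by (intro exI[of _ "Suc n"]) force
  qed
  then have "{W. W \<subseteq> A \<and> finite W} \<subseteq> (\<Union>n. subsets_by_insertions A n)"
    by blast
  moreover have "|\<Union>n. subsets_by_insertions A n| \<le>o |A|"
  proof (rule card_of_UNION_ordLeq_infinite[OF assms])
    show "|UNIV :: nat set| \<le>o |A|"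
      using assms infinite_iff_card_of_nat by blast
    show "\<forall>n\<in>UNIV. |subsets_by_insertions A n| \<le>o |A|"
      using card_of_subsets_by_insertions[OF assms] by blast
  qed
  ultimately show ?thesis
    using card_of_mono1 ordLeq_transitive by blast
qed

lemma ex_enumeration_finite_subsets:
  assumes "infinite A"
  obtains e where "e ` A = {W. W \<subseteq> A \<and> finite W}"
proof -
  have "\<exists>e. e ` A = {W. W \<subseteq> A \<and> finite W}"
    using card_of_finite_subsets[OF assms] by (subst card_of_ordLeq2) auto
  then show ?thesis using that by blast
qed

lemma card_of_UNION_finite_ordLess:
  assumes "Card_order \<mu>" "infinite (Field \<mu>)" and Z: "|Z| <o \<mu>"
    and e: "\<And>\<alpha>. \<alpha> \<in> Z \<Longrightarrow> finite (e \<alpha>)"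
  shows "|\<Union>\<alpha>\<in>Z. e \<alpha>| <o \<mu>"
proof (cases "finite Z")
  case True
  then have "|\<Union>\<alpha>\<in>Z. e \<alpha>| <o |Field \<mu>|"
    using e assms(2) by (intro card_of_finite_ordLess_infinite) auto
  then show ?thesis
    using card_of_Field_ordIso[OF assms(1)] ordLess_ordIso_trans by blast
next
  \<comment> \<open>The bound is \<open>Z\<close> itself: bounding by \<open>\<mu>\<close> would give only a weak inequality.\<close>
  case False
  then have "|\<Union>\<alpha>\<in>Z. e \<alpha>| \<le>o |Z|"
    using e by (intro card_of_UNION_ordLeq_infinite ballI)
      (auto intro: ordLess_imp_ordLeq card_of_finite_ordLess_infinite
        card_of_refl[THEN ordIso_imp_ordLeq])
  then show ?thesis using Z ordLeq_ordLess_trans by blast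
qed

section \<open>Sequences of sets and families of open sets\<close>

text \<open>Passing to closures only enlarges the sets, so the same witnesses remain valid.\<close>

lemma O_compactD_subsets:
  assumes "O_compact \<mu> \<Lambda> X"
    and sub: "\<And>\<alpha>. \<alpha> \<in> Field \<Lambda> \<Longrightarrow> P \<alpha> \<subseteq> topspace X"
    and U: "\<And>Z. Z \<in> small_subsets \<mu> \<Lambda> \<Longrightarrow>
      \<exists>U. openin X U \<and> U \<noteq> {} \<and> U \<subseteq> Inter_in X Z P"
  shows "Inter_in X (Field \<Lambda>) (\<lambda>\<alpha>. X closure_of P \<alpha>) \<noteq> {}"
proof -
  have "Inter_in X Z P \<subseteq> Inter_in X Z (\<lambda>\<alpha>. X closure_of P \<alpha>)"
    if "Z \<in> small_subsets \<mu> \<Lambda>" for Z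
    using that sub closure_of_subset[of "P _" X] by (fastforce simp: Inter_in_def small_subsets_def)
  then have "\<forall>Z\<in>small_subsets \<mu> \<Lambda>. \<exists>U. openin X U \<and> U \<noteq> {} \<and>
      U \<subseteq> Inter_in X Z (\<lambda>\<alpha>. X closure_of P \<alpha>)"
    using U by (meson subset_trans)
  then show ?thesis
    using assms(1) unfolding O_compact_def by simp
qed

text \<open>
  From open sequences to families: the sequence \<open>\<alpha> \<mapsto> \<Union>{U Z | \<alpha> \<in> Z}\<close> is open, and
  \<open>U Z\<close> is contained in each of its members with \<open>\<alpha> \<in> Z\<close>.
\<close>

lemma family_closures_meet:
  assumes open_sequences: "\<And>Q :: 'i \<Rightarrow> 'a set.
      \<lbrakk>\<forall>\<alpha>\<in>Field \<Lambda>. openin X (Q \<alpha>);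
       \<forall>Z\<in>small_subsets \<mu> \<Lambda>. \<exists>U. openin X U \<and> U \<noteq> {} \<and> U \<subseteq> Inter_in X Z Q\<rbrakk>
      \<Longrightarrow> Inter_in X (Field \<Lambda>) (\<lambda>\<alpha>. X closure_of Q \<alpha>) \<noteq> {}"
    and U: "\<And>Z. Z \<in> small_subsets \<mu> \<Lambda> \<Longrightarrow> openin X (U Z) \<and> U Z \<noteq> {}"
  shows "Inter_in X (Field \<Lambda>)
    (\<lambda>\<alpha>. X closure_of \<Union> {U Z | Z. Z \<in> small_subsets \<mu> \<Lambda> \<and> \<alpha> \<in> Z}) \<noteq> {}"
proof (rule open_sequences)
  show "\<forall>\<alpha>\<in>Field \<Lambda>. openin X (\<Union> {U Z | Z. Z \<in> small_subsets \<mu> \<Lambda> \<and> \<alpha> \<in> Z})"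
    using U by (blast intro: openin_Union)
  have "U Z \<subseteq> Inter_in X Z (\<lambda>\<alpha>. \<Union> {U Z | Z. Z \<in> small_subsets \<mu> \<Lambda> \<and> \<alpha> \<in> Z})"
    if "Z \<in> small_subsets \<mu> \<Lambda>" for Z
    using that U[OF that] openin_subset[of X "U Z"] by (auto simp: Inter_in_def)
  then show "\<forall>Z\<in>small_subsets \<mu> \<Lambda>. \<exists>V. openin X V \<and> V \<noteq> {} \<and>
      V \<subseteq> Inter_in X Z (\<lambda>\<alpha>. \<Union> {U Z | Z. Z \<in> small_subsets \<mu> \<Lambda> \<and> \<alpha> \<in> Z})"
    using U by meson
qed

text \<open>
  From families back to closed sequences: for chosen witnesses \<open>U Z\<close>, the closed set \<open>C \<alpha>\<close>
  contains every \<open>U Z\<close> with \<open>\<alpha> \<in> Z\<close>, hence also the closure of their union.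
\<close>

lemma O_compactI_families:
  fixes X :: "'a topology" and \<Lambda> :: "'i rel"
  assumes families: "\<And>U :: 'i set \<Rightarrow> 'a set.
      \<forall>Z\<in>small_subsets \<mu> \<Lambda>. openin X (U Z) \<and> U Z \<noteq> {} \<Longrightarrow>
      Inter_in X (Field \<Lambda>)
        (\<lambda>\<alpha>. X closure_of \<Union> {U Z | Z. Z \<in> small_subsets \<mu> \<Lambda> \<and> \<alpha> \<in> Z}) \<noteq> {}"
  shows "O_compact \<mu> \<Lambda> X"
  unfolding O_compact_def
proof (intro allI impI)
  fix C :: "'i \<Rightarrow> 'a set"
  assume closed: "\<forall>\<alpha>\<in>Field \<Lambda>. closedin X (C \<alpha>)"
    and "\<forall>Z\<in>small_subsets \<mu> \<Lambda>. \<exists>U. openin X U \<and> U \<noteq> {} \<and> U \<subseteq> Inter_in X Z C"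
  then obtain U where U: "\<forall>Z\<in>small_subsets \<mu> \<Lambda>.
      openin X (U Z) \<and> U Z \<noteq> {} \<and> U Z \<subseteq> Inter_in X Z C"
    by metis
  have "X closure_of \<Union> {U Z | Z. Z \<in> small_subsets \<mu> \<Lambda> \<and> \<alpha> \<in> Z} \<subseteq> C \<alpha>"
    if "\<alpha> \<in> Field \<Lambda>" for \<alpha>
    using that closed U by (intro closure_of_minimal) (auto simp: Inter_in_def, blast)
  moreover have "Inter_in X (Field \<Lambda>)
      (\<lambda>\<alpha>. X closure_of \<Union> {U Z | Z. Z \<in> small_subsets \<mu> \<Lambda> \<and> \<alpha> \<in> Z}) \<noteq> {}"
    using U by (intro families) blast
  ultimately obtain x where x: "x \<in> topspace X"
    and "\<forall>\<alpha>\<in>Field \<Lambda>. x \<in> C \<alpha>"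
    unfolding Inter_in_def ex_in_conv[symmetric] Int_iff INT_iff by (meson subsetD)
  then show "Inter_in X (Field \<Lambda>) C \<noteq> {}"
    using x unfolding Inter_in_def by blast
qed

section \<open>Finite sets of indices\<close>

text \<open>
  Reindexing along the enumeration \<open>e\<close>: if \<open>\<alpha> \<in> Y\<close> and \<open>e \<alpha> = W\<close>, then \<open>W\<close> lies in the small set
  \<open>\<Union>\<beta>\<in>Y. e \<beta>\<close>, so the union attached to \<open>\<alpha>\<close> in the reindexed family is contained in the union
  attached to \<open>W\<close> in the original one.
\<close>

lemma family_closures_meet_finite:
  fixes X :: "'a topology" and \<Lambda> :: "'i rel"
  assumes "infinite (Field \<Lambda>)" "Card_order \<mu>" "infinite (Field \<mu>)"
    and families: "\<And>U :: 'i set \<Rightarrow> 'a set.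
      \<forall>Z\<in>small_subsets \<mu> \<Lambda>. openin X (U Z) \<and> U Z \<noteq> {} \<Longrightarrow>
      Inter_in X (Field \<Lambda>)
        (\<lambda>\<alpha>. X closure_of \<Union> {U Z | Z. Z \<in> small_subsets \<mu> \<Lambda> \<and> \<alpha> \<in> Z}) \<noteq> {}"
    and U: "\<forall>Z\<in>small_subsets \<mu> \<Lambda>. openin X (U Z) \<and> U Z \<noteq> {}"
  shows "Inter_in X {W. W \<subseteq> Field \<Lambda> \<and> finite W}
    (\<lambda>W. X closure_of \<Union> {U Z | Z. Z \<in> small_subsets \<mu> \<Lambda> \<and> W \<subseteq> Z}) \<noteq> {}"
proof -
  obtain e where e: "e ` Field \<Lambda> = {W. W \<subseteq> Field \<Lambda> \<and> finite W}"
    using ex_enumeration_finite_subsets[OF assms(1)] .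
  let ?E = "\<lambda>Y. \<Union>\<beta>\<in>Y. e \<beta>"
  have small: "?E Y \<in> small_subsets \<mu> \<Lambda>" if "Y \<in> small_subsets \<mu> \<Lambda>" for Y
  proof -
    have Y: "Y \<subseteq> Field \<Lambda>" "|Y| <o \<mu>" using that by (auto simp: small_subsets_def)
    then have e_fin: "e \<beta> \<subseteq> Field \<Lambda> \<and> finite (e \<beta>)" if "\<beta> \<in> Y" for \<beta>
      using e that by blast
    then have "|?E Y| <o \<mu>"
      by (intro card_of_UNION_finite_ordLess assms Y) auto
    then show ?thesis using e_fin by (auto simp: small_subsets_def)
  qed
  have mono: "X closure_of \<Union> {U (?E Y) | Y. Y \<in> small_subsets \<mu> \<Lambda> \<and> \<alpha> \<in> Y}
      \<subseteq> X closure_of \<Union> {U Z | Z. Z \<in> small_subsets \<mu> \<Lambda> \<and> e \<alpha> \<subseteq> Z}" for \<alpha>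
    by (intro closure_of_mono Union_mono) (use small in blast)
  have "Inter_in X (Field \<Lambda>)
      (\<lambda>\<alpha>. X closure_of \<Union> {U (?E Y) | Y. Y \<in> small_subsets \<mu> \<Lambda> \<and> \<alpha> \<in> Y}) \<noteq> {}"
    using U small by (intro families) blast
  then obtain x where x: "x \<in> topspace X"
    "\<And>\<alpha>. \<alpha> \<in> Field \<Lambda> \<Longrightarrow>
      x \<in> X closure_of \<Union> {U (?E Y) | Y. Y \<in> small_subsets \<mu> \<Lambda> \<and> \<alpha> \<in> Y}"
    unfolding Inter_in_def by blast
  have "x \<in> X closure_of \<Union> {U Z | Z. Z \<in> small_subsets \<mu> \<Lambda> \<and> W \<subseteq> Z}"
    if W: "W \<subseteq> Field \<Lambda>" "finite W" for W
  proof -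
    obtain \<alpha> where "\<alpha> \<in> Field \<Lambda>" "e \<alpha> = W"
      using e W by (metis (mono_tags, lifting) imageE mem_Collect_eq)
    then show ?thesis using x(2) mono by blast
  qed
  then show ?thesis using x(1) unfolding Inter_in_def by blast
qed

text \<open>The finite sets \<open>W\<close> include the singletons, which recover the single indices.\<close>

lemma family_closures_meet_from_finite:
  assumes "Inter_in X {W. W \<subseteq> Field \<Lambda> \<and> finite W}
    (\<lambda>W. X closure_of \<Union> {U Z | Z. Z \<in> small_subsets \<mu> \<Lambda> \<and> W \<subseteq> Z}) \<noteq> {}"
  shows "Inter_in X (Field \<Lambda>)
    (\<lambda>\<alpha>. X closure_of \<Union> {U Z | Z. Z \<in> small_subsets \<mu> \<Lambda> \<and> \<alpha> \<in> Z}) \<noteq> {}"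
proof -
  obtain x where x: "x \<in> topspace X"
    "\<And>W. W \<subseteq> Field \<Lambda> \<Longrightarrow> finite W \<Longrightarrow>
      x \<in> X closure_of \<Union> {U Z | Z. Z \<in> small_subsets \<mu> \<Lambda> \<and> W \<subseteq> Z}"
    using assms unfolding Inter_in_def by blast
  have "x \<in> X closure_of \<Union> {U Z | Z. Z \<in> small_subsets \<mu> \<Lambda> \<and> \<alpha> \<in> Z}" if "\<alpha> \<in> Field \<Lambda>" for \<alpha>
    using x(2)[of "{\<alpha>}"] that by simp
  then show ?thesis using x(1) unfolding Inter_in_def by blast
qed

section \<open>Complements\<close>

text \<open>
  De Morgan: the complement of the closure of a union is the interior of the intersection of the
  complements, and a point in all closures is one that these interiors do not cover.
\<close>

lemma closures_meet_iff_interiors_not_cover: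
  assumes "\<And>Z. Z \<in> \<Z> \<Longrightarrow> C Z = topspace X - U Z"
  shows "Inter_in X I (\<lambda>\<alpha>. X closure_of \<Union> {U Z | Z. Z \<in> \<Z> \<and> \<alpha> \<in> Z}) \<noteq> {} \<longleftrightarrow>
    \<not> topspace X \<subseteq> (\<Union>\<alpha>\<in>I. X interior_of Inter_in X {Z \<in> \<Z>. \<alpha> \<in> Z} C)"
proof -
  have "Inter_in X {Z \<in> \<Z>. \<alpha> \<in> Z} C = topspace X - \<Union> {U Z | Z. Z \<in> \<Z> \<and> \<alpha> \<in> Z}" for \<alpha>
    using assms by (auto simp: Inter_in_def)
  then have "X interior_of Inter_in X {Z \<in> \<Z>. \<alpha> \<in> Z} C
      = topspace X - X closure_of \<Union> {U Z | Z. Z \<in> \<Z> \<and> \<alpha> \<in> Z}" for \<alpha>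
    by (simp add: interior_of_complement)
  then show ?thesis unfolding Inter_in_def by auto
qed

lemma families_iff_closed_families:
  fixes X :: "'a topology" and \<Z> :: "'i set set"
  shows "(\<forall>U :: 'i set \<Rightarrow> 'a set. (\<forall>Z\<in>\<Z>. openin X (U Z) \<and> U Z \<noteq> {}) \<longrightarrow>
      Inter_in X I (\<lambda>\<alpha>. X closure_of \<Union> {U Z | Z. Z \<in> \<Z> \<and> \<alpha> \<in> Z}) \<noteq> {}) \<longleftrightarrow>
    (\<forall>C :: 'i set \<Rightarrow> 'a set. (\<forall>Z\<in>\<Z>. closedin X (C Z) \<and> C Z \<subset> topspace X) \<longrightarrow>
      \<not> topspace X \<subseteq> (\<Union>\<alpha>\<in>I. X interior_of Inter_in X {Z \<in> \<Z>. \<alpha> \<in> Z} C))"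
    (is "?open \<longleftrightarrow> ?closed")
proof
  assume L: ?open
  show ?closed
  proof (intro allI impI)
    fix C :: "'i set \<Rightarrow> 'a set"
    assume C: "\<forall>Z\<in>\<Z>. closedin X (C Z) \<and> C Z \<subset> topspace X"
    define U where "U Z = topspace X - C Z" for Z
    have "\<forall>Z\<in>\<Z>. openin X (U Z) \<and> U Z \<noteq> {}"
      using C by (auto simp: U_def)
    moreover have "C Z = topspace X - U Z" if "Z \<in> \<Z>" for Z
      using C that by (auto simp: U_def)
    ultimately show "\<not> topspace X \<subseteq> (\<Union>\<alpha>\<in>I. X interior_of Inter_in X {Z \<in> \<Z>. \<alpha> \<in> Z} C)"
      using L closures_meet_iff_interiors_not_cover[of \<Z> C X U I] by blast
  qed
next
  assume R: ?closed
  show ?open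
  proof (intro allI impI)
    fix U :: "'i set \<Rightarrow> 'a set"
    assume U: "\<forall>Z\<in>\<Z>. openin X (U Z) \<and> U Z \<noteq> {}"
    define C where "C Z = topspace X - U Z" for Z
    have "\<forall>Z\<in>\<Z>. closedin X (C Z) \<and> C Z \<subset> topspace X"
      using U openin_subset[of X] by (fastforce simp: C_def)
    then have "\<not> topspace X \<subseteq> (\<Union>\<alpha>\<in>I. X interior_of Inter_in X {Z \<in> \<Z>. \<alpha> \<in> Z} C)"
      using R by blast
    then show "Inter_in X I (\<lambda>\<alpha>. X closure_of \<Union> {U Z | Z. Z \<in> \<Z> \<and> \<alpha> \<in> Z}) \<noteq> {}"
      using closures_meet_iff_interiors_not_cover[of \<Z> C X U I] by (simp add: C_def)
  qed
qed

section \<open>The equivalences\<close>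

theorem proposition2p4:
  fixes X :: "'a topology" and \<Lambda> :: "'i rel" and \<mu> :: "'c rel"
  assumes "Card_order \<Lambda>" and "infinite (Field \<Lambda>)"
    and "Card_order \<mu>" and "infinite (Field \<mu>)"
  shows
    "(O_compact \<mu> \<Lambda> X
      \<longleftrightarrow>
      (\<forall>P :: 'i \<Rightarrow> 'a set.
        (\<forall>\<alpha>\<in>Field \<Lambda>. P \<alpha> \<subseteq> topspace X) \<longrightarrow>
        (\<forall>Z\<in>small_subsets \<mu> \<Lambda>. \<exists>U. openin X U \<and> U \<noteq> {} \<and> U \<subseteq> Inter_in X Z P) \<longrightarrow>
        Inter_in X (Field \<Lambda>) (\<lambda>\<alpha>. X closure_of P \<alpha>) \<noteq> {}))
    \<and>
    (O_compact \<mu> \<Lambda> X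
      \<longleftrightarrow>
      (\<forall>Q :: 'i \<Rightarrow> 'a set.
        (\<forall>\<alpha>\<in>Field \<Lambda>. openin X (Q \<alpha>)) \<longrightarrow>
        (\<forall>Z\<in>small_subsets \<mu> \<Lambda>. \<exists>U. openin X U \<and> U \<noteq> {} \<and> U \<subseteq> Inter_in X Z Q) \<longrightarrow>
        Inter_in X (Field \<Lambda>) (\<lambda>\<alpha>. X closure_of Q \<alpha>) \<noteq> {}))
    \<and>
    (O_compact \<mu> \<Lambda> X
      \<longleftrightarrow>
      (\<forall>U :: 'i set \<Rightarrow> 'a set.
        (\<forall>Z\<in>small_subsets \<mu> \<Lambda>. openin X (U Z) \<and> U Z \<noteq> {}) \<longrightarrow>
        Inter_in X (Field \<Lambda>)
          (\<lambda>\<alpha>. X closure_of \<Union> {U Z | Z. Z \<in> small_subsets \<mu> \<Lambda> \<and> \<alpha> \<in> Z}) \<noteq> {}))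
    \<and>
    (O_compact \<mu> \<Lambda> X
      \<longleftrightarrow>
      (\<forall>U :: 'i set \<Rightarrow> 'a set.
        (\<forall>Z\<in>small_subsets \<mu> \<Lambda>. openin X (U Z) \<and> U Z \<noteq> {}) \<longrightarrow>
        Inter_in X {W. W \<subseteq> Field \<Lambda> \<and> finite W}
          (\<lambda>W. X closure_of \<Union> {U Z | Z. Z \<in> small_subsets \<mu> \<Lambda> \<and> W \<subseteq> Z}) \<noteq> {}))
    \<and>
    (O_compact \<mu> \<Lambda> X
      \<longleftrightarrow>
      (\<forall>C :: 'i set \<Rightarrow> 'a set.
        (\<forall>Z\<in>small_subsets \<mu> \<Lambda>. closedin X (C Z) \<and> C Z \<subset> topspace X) \<longrightarrow>
        \<not> topspace X \<subseteq>
          (\<Union>\<alpha>\<in>Field \<Lambda>.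
            X interior_of Inter_in X {Z \<in> small_subsets \<mu> \<Lambda>. \<alpha> \<in> Z} C)))"
    (is "(_ \<longleftrightarrow> ?subsets) \<and> (_ \<longleftrightarrow> ?open) \<and> (_ \<longleftrightarrow> ?families) \<and>
      (_ \<longleftrightarrow> ?finite) \<and> (_ \<longleftrightarrow> ?closed)")
proof -
  have cycle: "(A \<longleftrightarrow> P) \<and> (A \<longleftrightarrow> Q) \<and> (A \<longleftrightarrow> R) \<and> (A \<longleftrightarrow> S) \<and> (A \<longleftrightarrow> T)"
    if "A \<Longrightarrow> P" "P \<Longrightarrow> Q" "Q \<Longrightarrow> R" "R \<Longrightarrow> A"
      and "R \<Longrightarrow> S" "S \<Longrightarrow> R" and "R \<longleftrightarrow> T" for A P Q R S T
    using that by blast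
  show ?thesis
  proof (rule cycle)
    show "?subsets" if "O_compact \<mu> \<Lambda> X"
      by (intro allI impI, rule O_compactD_subsets[OF that]) simp_all
    show "?open" if "?subsets"
      by (intro allI impI, rule that[rule_format]) (simp_all add: openin_subset)
    show "?families" if "?open"
      by (intro allI impI, rule family_closures_meet, rule that[rule_format]) simp_all
    show "O_compact \<mu> \<Lambda> X" if "?families"
      by (rule O_compactI_families, rule that[rule_format]) simp
    show "?finite" if "?families"
      by (intro allI impI, rule family_closures_meet_finite[OF assms(2-4)], rule that[rule_format])
        simp_all
    show "?families" if "?finite"
      by (intro allI impI, rule family_closures_meet_from_finite, rule that[rule_format]) simp
    show "?families \<longleftrightarrow> ?closed"
      by (rule families_iff_closed_families)
  qed
qed

end
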